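(* Let $q\ge 1$ be real, let $n\ge 3$, $l\ge 1$, $m\ge 1$ be integers, let $\overline{CI}\in[0,1]$, and let $\lambda=(\lambda_1,\dots,\lambda_m)^T$ be a weight vector with $0\le\lambda_t\le 1$ for all $t$ and $\sum_{t=1}^m\lambda_t=1$. Let $A_t=(a_{ijt})_{n\times n}$, $t=1,\dots,m$, be q-rung orthopair hesitant fuzzy preference relations (q-ROHFPRs) on $X=\{x_1,\dots,x_n\}$, with $a_{ijt}=\langle\{\mu_{ijt}^1,\dots,\mu_{ijt}^l\},\{v_{ijt}^1,\dots,v_{ijt}^l\}\rangle$, and let $A=(a_{ij})_{n\times n}$ be their aggregated q-ROHFPR with weight vector $\lambda$. If every individual q-ROHFPR $A_t$ ($t=1,\dots,m$) is acceptably additive consistent, i.e. $CI(A_t)\le\overline{CI}$ for all $t$, then the aggregated q-ROHFPR $A$ is also acceptably additive consistent, i.e. $CI(A)\le\overline{CI}$.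
   Context: **q-ROHFPR.** Fix a real $q\ge 1$ and an integer $l\ge1$. A q-rung orthopair hesitant fuzzy preference relation (q-ROHFPR) on a set of alternatives $X=\{x_1,\dots,x_n\}$ is an $n\times n$ matrix $A=(a_{ij})_{n\times n}$ whose entries are pairs $a_{ij}=\langle\{\mu_{ij}^{1},\dots,\mu_{ij}^{l}\},\{v_{ij}^{1},\dots,v_{ij}^{l}\}\rangle$ of lists of $l$ real numbers each (possible membership degrees and possible non-membership degrees), each list arranged from small to large, such that for all $i,j\in\{1,\dots,n\}$ and $s\in\{1,\dots,l\}$: - $0\le \mu_{ij}^{s}\le 1$, $0\le v_{ij}^{s}\le 1$, and $0\le(\mu_{ij}^{s})^q+(v_{ij}^{s})^q\le 1$; - $\mu_{ii}^{s}=v_{ii}^{s}=2^{-1/q}$; - $\mu_{ij}^{s}=v_{ji}^{s}$ and $\mu_{ji}^{s}=v_{ij}^{s}$. The number $l$ of elements is the same for all entries of all the matrices considered. **Consistency index.** For a q-ROHFPR $A$ with $n\ge3$, $$CI(A)=\frac{1}{l}\,\frac{2}{n(n-1)(n-2)}\sum_{1\le i<j<k\le n}\ \sum_{s=1}^{l}\left|(\mu_{ij}^{s})^q+(\mu_{jk}^{s})^q+(v_{ik}^{s})^q-(v_{ij}^{s})^q-(v_{jk}^{s})^q-(\mu_{ik}^{s})^q\right|.$$ **Acceptable additive consistency.** Given a threshold $\overline{CI}\in[0,1]$, a q-ROHFPR $A$ is called acceptably additive consistent if $CI(A)\le\overline{CI}$. The same threshold is used for all matrices. **Aggregation.** Given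 q-ROHFPRs $A_t=(a_{ijt})_{n\times n}$, $t=1,\dots,m$, with $a_{ijt}=\langle\{\mu_{ijt}^1,\dots,\mu_{ijt}^l\},\{v_{ijt}^1,\dots,v_{ijt}^l\}\rangle$, and weights $\lambda_t$, the aggregated matrix $A=(a_{ij})_{n\times n}$ has entries $a_{ij}=\langle\{\mu_{ij}^1,\dots,\mu_{ij}^l\},\{v_{ij}^1,\dots,v_{ij}^l\}\rangle$, where for all $i,j,s$ $$\mu_{ij}^{s}=\Bigl(\sum_{t=1}^{m}\lambda_t(\mu_{ijt}^{s})^q\Bigr)^{1/q},\qquad v_{ij}^{s}=\Bigl(\sum_{t=1}^{m}\lambda_t(v_{ijt}^{s})^q\Bigr)^{1/q}.$$ The matrix $A$ is again a q-ROHFPR. *)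

theory Defs
  imports Complex_Main
begin

text \<open>
  An entry is a pair of lists (possible membership degrees, possible non-membership degrees).
  Matrix indices range over \<open>{1..n}\<close>; positions \<open>s\<close> inside the lists are 0-based, \<open>s < l\<close>.
\<close>

type_synonym qrohf_matrix = "nat \<Rightarrow> nat \<Rightarrow> real list \<times> real list"

definition memb :: "qrohf_matrix \<Rightarrow> nat \<Rightarrow> nat \<Rightarrow> nat \<Rightarrow> real" where
  "memb A i j s = fst (A i j) ! s"

definition nonmemb :: "qrohf_matrix \<Rightarrow> nat \<Rightarrow> nat \<Rightarrow> nat \<Rightarrow> real" where
  "nonmemb A i j s = snd (A i j) ! s"

definition is_qrohfpr :: "real \<Rightarrow> nat \<Rightarrow> nat \<Rightarrow> qrohf_matrix \<Rightarrow> bool" where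
  "is_qrohfpr q l n A \<longleftrightarrow>
     (\<forall>i\<in>{1..n}. \<forall>j\<in>{1..n}.
        length (fst (A i j)) = l \<and> length (snd (A i j)) = l \<and>
        sorted (fst (A i j)) \<and> sorted (snd (A i j)) \<and>
        (\<forall>s<l. 0 \<le> memb A i j s \<and> memb A i j s \<le> 1 \<and>
               0 \<le> nonmemb A i j s \<and> nonmemb A i j s \<le> 1 \<and>
               0 \<le> memb A i j s powr q + nonmemb A i j s powr q \<and>
               memb A i j s powr q + nonmemb A i j s powr q \<le> 1 \<and>
               memb A i i s = 2 powr (- 1 / q) \<and> nonmemb A i i s = 2 powr (- 1 / q) \<and>
               memb A i j s = nonmemb A j i s \<and> memb A j i s = nonmemb A i j s))"

definition CI :: "real \<Rightarrow> nat \<Rightarrow> nat \<Rightarrow> qrohf_matrix \<Rightarrow> real" where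
  "CI q l n A =
     1 / real l * (2 / (real n * (real n - 1) * (real n - 2))) *
     (\<Sum>i\<in>{1..n}. \<Sum>j\<in>{i<..n}. \<Sum>k\<in>{j<..n}. \<Sum>s<l.
        \<bar>memb A i j s powr q + memb A j k s powr q + nonmemb A i k s powr q
         - nonmemb A i j s powr q - nonmemb A j k s powr q - memb A i k s powr q\<bar>)"

text \<open>The notion applies to q-ROHFPRs only, so being one is part of the predicate.\<close>

definition acceptably_additive_consistent ::
  "real \<Rightarrow> nat \<Rightarrow> nat \<Rightarrow> real \<Rightarrow> qrohf_matrix \<Rightarrow> bool" where
  "acceptably_additive_consistent q l n c A \<longleftrightarrow> is_qrohfpr q l n A \<and> CI q l n A \<le> c"

definition aggregate ::
  "real \<Rightarrow> nat \<Rightarrow> nat \<Rightarrow> (nat \<Rightarrow> real) \<Rightarrow> (nat \<Rightarrow> qrohf_matrix) \<Rightarrow> qrohf_matrix" where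
  "aggregate q l m w As = (\<lambda>i j.
     (map (\<lambda>s. (\<Sum>t\<in>{1..m}. w t * memb (As t) i j s powr q) powr (1 / q)) [0..<l],
      map (\<lambda>s. (\<Sum>t\<in>{1..m}. w t * nonmemb (As t) i j s powr q) powr (1 / q)) [0..<l]))"

end

theory Submission
  imports Defs
begin

text \<open>
  The \<open>q\<close>-th power of an aggregated degree is the weighted arithmetic mean of the \<open>q\<close>-th powers of
  the individual degrees (\<open>memb_aggregate_powr\<close>, \<open>nonmemb_aggregate_powr\<close>). The expression inside
  the absolute value of \<open>CI\<close> is linear in those \<open>q\<close>-th powers, so the triangle inequality makes
  \<open>CI\<close> a convex function of the matrix: \<open>CI\<close> of the aggregate is at most the weighted mean of the
  individual indices (\<open>CI_aggregate_le\<close>), hence at most any common bound for them.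

  The aggregate is again a q-ROHFPR (\<open>is_qrohfpr_aggregate\<close>): monotonicity of \<open>x powr q\<close> and
  \<open>x powr (1 / q)\<close> preserves the order of the lists, and all other conditions are preserved by
  weighted means of \<open>q\<close>-th powers.
\<close>

section \<open>Weighted means\<close>

lemma weighted_mean_nonneg:
  fixes w x :: "'a \<Rightarrow> real"
  assumes "\<forall>t\<in>T. 0 \<le> w t" and "\<forall>t\<in>T. 0 \<le> x t"
  shows "0 \<le> (\<Sum>t\<in>T. w t * x t)"
  using assms by (intro sum_nonneg) auto

lemma weighted_mean_mono:
  fixes w x y :: "'a \<Rightarrow> real"
  assumes "\<forall>t\<in>T. 0 \<le> w t" and "\<forall>t\<in>T. x t \<le> y t"
  shows "(\<Sum>t\<in>T. w t * x t) \<le> (\<Sum>t\<in>T. w t * y t)"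
  using assms by (intro sum_mono mult_left_mono) auto

lemma weighted_mean_le:
  fixes w x :: "'a \<Rightarrow> real"
  assumes "\<forall>t\<in>T. 0 \<le> w t" and "(\<Sum>t\<in>T. w t) = 1" and "\<forall>t\<in>T. x t \<le> b"
  shows "(\<Sum>t\<in>T. w t * x t) \<le> b"
  using weighted_mean_mono[OF assms(1,3)] assms(2) by (simp flip: sum_distrib_right)

section \<open>Entries of the aggregated matrix\<close>

lemma memb_aggregate:
  assumes "s < l"
  shows "memb (aggregate q l m w As) i j s
    = (\<Sum>t\<in>{1..m}. w t * memb (As t) i j s powr q) powr (1 / q)"
  using assms by (simp add: memb_def aggregate_def)

lemma nonmemb_aggregate:
  assumes "s < l"
  shows "nonmemb (aggregate q l m w As) i j s
    = (\<Sum>t\<in>{1..m}. w t * nonmemb (As t) i j s powr q) powr (1 / q)"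
  using assms by (simp add: nonmemb_def aggregate_def)

lemma memb_aggregate_powr:
  assumes "s < l" and "q \<noteq> 0" and "\<forall>t\<in>{1..m}. 0 \<le> w t"
  shows "memb (aggregate q l m w As) i j s powr q
    = (\<Sum>t\<in>{1..m}. w t * memb (As t) i j s powr q)"
  using assms by (simp add: memb_aggregate powr_powr weighted_mean_nonneg)

lemma nonmemb_aggregate_powr:
  assumes "s < l" and "q \<noteq> 0" and "\<forall>t\<in>{1..m}. 0 \<le> w t"
  shows "nonmemb (aggregate q l m w As) i j s powr q
    = (\<Sum>t\<in>{1..m}. w t * nonmemb (As t) i j s powr q)"
  using assms by (simp add: nonmemb_aggregate powr_powr weighted_mean_nonneg)

section \<open>The aggregate is a preference relation\<close>

text \<open>Both components of an aggregated entry have the form treated in the next lemma.\<close>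

lemma sorted_power_means:
  fixes q :: real and f :: "'a \<Rightarrow> nat \<Rightarrow> real"
  assumes "q > 0" and "\<forall>t\<in>T. 0 \<le> w t"
    and "\<forall>t\<in>T. \<forall>s<l. 0 \<le> f t s"
    and "\<forall>t\<in>T. \<forall>r s. r \<le> s \<longrightarrow> s < l \<longrightarrow> f t r \<le> f t s"
  shows "sorted (map (\<lambda>s. (\<Sum>t\<in>T. w t * f t s powr q) powr (1 / q)) [0..<l])"
  unfolding sorted_iff_nth_mono
proof (clarsimp)
  fix r s assume "r \<le> s" "s < l"
  then show "(\<Sum>t\<in>T. w t * f t r powr q) powr (1 / q)
    \<le> (\<Sum>t\<in>T. w t * f t s powr q) powr (1 / q)"
    using assms by (intro powr_mono2 weighted_mean_mono weighted_mean_nonneg ballI) auto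
qed

lemma is_qrohfpr_aggregate:
  assumes q: "q > 0"
    and w: "\<forall>t\<in>{1..m}. 0 \<le> w t" "(\<Sum>t\<in>{1..m}. w t) = 1"
    and A: "\<forall>t\<in>{1..m}. is_qrohfpr q l n (As t)"
  shows "is_qrohfpr q l n (aggregate q l m w As)"
proof -
  let ?A = "aggregate q l m w As"
  have sorted: "sorted (fst (?A i j)) \<and> sorted (snd (?A i j))"
    if "i \<in> {1..n}" "j \<in> {1..n}" for i j
  proof -
    have "sorted (fst (As t i j)) \<and> sorted (snd (As t i j)) \<and>
        length (fst (As t i j)) = l \<and> length (snd (As t i j)) = l"
      if "t \<in> {1..m}" for t
      using A that \<open>i \<in> _\<close> \<open>j \<in> _\<close> unfolding is_qrohfpr_def by blast
    then have mono:
      "\<forall>t\<in>{1..m}. \<forall>r s. r \<le> s \<longrightarrow> s < l \<longrightarrow> memb (As t) i j r \<le> memb (As t) i j s"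
      "\<forall>t\<in>{1..m}. \<forall>r s. r \<le> s \<longrightarrow> s < l \<longrightarrow> nonmemb (As t) i j r \<le> nonmemb (As t) i j s"
      by (auto simp: memb_def nonmemb_def intro!: sorted_nth_mono)
    have nonneg:
      "\<forall>t\<in>{1..m}. \<forall>s<l. 0 \<le> memb (As t) i j s"
      "\<forall>t\<in>{1..m}. \<forall>s<l. 0 \<le> nonmemb (As t) i j s"
      using A that unfolding is_qrohfpr_def by blast+
    show ?thesis
      using sorted_power_means[OF q w(1) nonneg(1) mono(1)]
        sorted_power_means[OF q w(1) nonneg(2) mono(2)]
      by (simp add: aggregate_def)
  qed
  have entries: "0 \<le> memb ?A i j s \<and> memb ?A i j s \<le> 1 \<and>
      0 \<le> nonmemb ?A i j s \<and> nonmemb ?A i j s \<le> 1 \<and>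
      0 \<le> memb ?A i j s powr q + nonmemb ?A i j s powr q \<and>
      memb ?A i j s powr q + nonmemb ?A i j s powr q \<le> 1 \<and>
      memb ?A i i s = 2 powr (- 1 / q) \<and> nonmemb ?A i i s = 2 powr (- 1 / q) \<and>
      memb ?A i j s = nonmemb ?A j i s \<and> memb ?A j i s = nonmemb ?A i j s"
    if ij: "i \<in> {1..n}" "j \<in> {1..n}" and s: "s < l" for i j s
  proof -
    have At:
      "\<forall>t\<in>{1..m}. memb (As t) i j s powr q + nonmemb (As t) i j s powr q \<le> 1"
      "\<forall>t\<in>{1..m}. memb (As t) i i s = 2 powr (- 1 / q)"
      "\<forall>t\<in>{1..m}. nonmemb (As t) i i s = 2 powr (- 1 / q)"
      "\<forall>t\<in>{1..m}. memb (As t) i j s = nonmemb (As t) j i s"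
      "\<forall>t\<in>{1..m}. memb (As t) j i s = nonmemb (As t) i j s"
      using A ij s unfolding is_qrohfpr_def by blast+
    have sum_le: "memb ?A i j s powr q + nonmemb ?A i j s powr q \<le> 1"
      using weighted_mean_le[OF w At(1)] q w s
      by (simp add: memb_aggregate_powr nonmemb_aggregate_powr sum.distrib distrib_left)
    have nonneg: "0 \<le> memb ?A i j s" "0 \<le> nonmemb ?A i j s"
      using s by (simp_all add: memb_aggregate nonmemb_aggregate)
    have le1: "x \<le> 1" if "x powr q \<le> 1" "0 \<le> x" for x :: real
    proof (rule ccontr)
      assume "\<not> x \<le> 1"
      then have "1 < x powr q"
        using q by (simp add: gr_one_powr)
      with that show False by simp
    qed
    have "memb ?A i j s powr q \<le> 1" "nonmemb ?A i j s powr q \<le> 1"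
      using sum_le powr_ge_zero[of "memb ?A i j s" q] powr_ge_zero[of "nonmemb ?A i j s" q]
      by linarith+
    then have le: "memb ?A i j s \<le> 1" "nonmemb ?A i j s \<le> 1"
      using le1 nonneg by blast+
    have "(2 powr (- 1 / q)) powr q = 1 / (2::real)"
      using q by (simp only: powr_powr) (simp add: powr_minus_divide)
    \<comment> \<open>The weights sum to one, so the common diagonal value \<open>1 / 2\<close> of the powers survives.\<close>
    then have half: "(\<Sum>t\<in>{1..m}. w t * (2 powr (- 1 / q)) powr q) = 1 / 2"
      using w(2) by (simp only: flip: sum_distrib_right)
    have root: "(1 / 2) powr (1 / q) = 2 powr (- 1 / q)"
      by (simp add: powr_divide powr_minus_divide)
    have "(\<Sum>t\<in>{1..m}. w t * memb (As t) i i s powr q) = 1 / 2"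
      "(\<Sum>t\<in>{1..m}. w t * nonmemb (As t) i i s powr q) = 1 / 2"
      unfolding half[symmetric] using At(2,3) by (auto intro!: sum.cong)
    then have diag: "memb ?A i i s = 2 powr (- 1 / q)" "nonmemb ?A i i s = 2 powr (- 1 / q)"
      by (simp_all only: memb_aggregate[OF s] nonmemb_aggregate[OF s] root)
    have sym: "memb ?A i j s = nonmemb ?A j i s" "memb ?A j i s = nonmemb ?A i j s"
      using s At(4,5) by (simp_all add: memb_aggregate nonmemb_aggregate)
    show ?thesis
      using nonneg le sum_le diag sym by simp
  qed
  have "length (fst (?A i j)) = l \<and> length (snd (?A i j)) = l" for i j
    by (simp add: aggregate_def)
  then show ?thesis
    unfolding is_qrohfpr_def using sorted entries by blast
qed

section \<open>Convexity of the consistency index\<close>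

text \<open>
  The deviation of the triple \<open>(i, j, k)\<close> from additive consistency at position \<open>s\<close>, that is, the
  summand of \<open>CI\<close>.
\<close>

definition deviation :: "real \<Rightarrow> qrohf_matrix \<Rightarrow> nat \<Rightarrow> nat \<Rightarrow> nat \<Rightarrow> nat \<Rightarrow> real" where
  "deviation q A i j k s =
     \<bar>memb A i j s powr q + memb A j k s powr q + nonmemb A i k s powr q
      - nonmemb A i j s powr q - nonmemb A j k s powr q - memb A i k s powr q\<bar>"

lemma deviation_aggregate_le:
  assumes "s < l" and "q \<noteq> 0" and w: "\<forall>t\<in>{1..m}. 0 \<le> w t"
  shows "deviation q (aggregate q l m w As) i j k s
    \<le> (\<Sum>t\<in>{1..m}. w t * deviation q (As t) i j k s)"
proof -
  let ?d = "\<lambda>t. memb (As t) i j s powr q + memb (As t) j k s powr q + nonmemb (As t) i k s powr q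
    - nonmemb (As t) i j s powr q - nonmemb (As t) j k s powr q - memb (As t) i k s powr q"
  have "deviation q (aggregate q l m w As) i j k s = \<bar>\<Sum>t\<in>{1..m}. w t * ?d t\<bar>"
    using assms
    by (simp add: deviation_def memb_aggregate_powr nonmemb_aggregate_powr
        sum.distrib sum_subtractf distrib_left right_diff_distrib)
  also have "\<dots> \<le> (\<Sum>t\<in>{1..m}. \<bar>w t * ?d t\<bar>)"
    by (rule sum_abs)
  also have "\<dots> = (\<Sum>t\<in>{1..m}. w t * deviation q (As t) i j k s)"
    using w by (intro sum.cong) (simp_all add: deviation_def abs_mult)
  finally show ?thesis .
qed

lemma CI_aggregate_le:
  assumes "q \<noteq> 0" and n: "n \<ge> 2" and w: "\<forall>t\<in>{1..m}. 0 \<le> w t"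
  shows "CI q l n (aggregate q l m w As) \<le> (\<Sum>t\<in>{1..m}. w t * CI q l n (As t))"
proof -
  let ?C = "1 / real l * (2 / (real n * (real n - 1) * (real n - 2)))"
  let ?S = "\<lambda>A. \<Sum>i\<in>{1..n}. \<Sum>j\<in>{i<..n}. \<Sum>k\<in>{j<..n}. \<Sum>s<l. deviation q A i j k s"
  have CI: "CI q l n A = ?C * ?S A" for A
    by (simp add: CI_def deviation_def)
  have "?S (aggregate q l m w As)
    \<le> (\<Sum>i\<in>{1..n}. \<Sum>j\<in>{i<..n}. \<Sum>k\<in>{j<..n}. \<Sum>s<l.
          \<Sum>t\<in>{1..m}. w t * deviation q (As t) i j k s)"
    using assms by (intro sum_mono deviation_aggregate_le) auto
  also have "\<dots> = (\<Sum>t\<in>{1..m}. w t * ?S (As t))"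
    by (simp only: sum_distrib_left sum.swap[where B = "{1..m}"])
  finally have "?C * ?S (aggregate q l m w As) \<le> ?C * (\<Sum>t\<in>{1..m}. w t * ?S (As t))"
    using n by (intro mult_left_mono) auto
  also have "\<dots> = (\<Sum>t\<in>{1..m}. w t * CI q l n (As t))"
    unfolding CI sum_distrib_left[of ?C "\<lambda>t. w t * ?S (As t)"]
    by (intro sum.cong refl mult.left_commute)
  finally show ?thesis
    unfolding CI .
qed

section \<open>Acceptable consistency of the aggregate\<close>

theorem theorem1:
  fixes q c :: real and n l m :: nat
    and w :: "nat \<Rightarrow> real" and As :: "nat \<Rightarrow> qrohf_matrix"
  assumes "q \<ge> 1" and "n \<ge> 3" and "l \<ge> 1" and "m \<ge> 1"
    and "0 \<le> c" and "c \<le> 1"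
    and "\<forall>t\<in>{1..m}. 0 \<le> w t \<and> w t \<le> 1"
    and "(\<Sum>t\<in>{1..m}. w t) = 1"
    and "\<forall>t\<in>{1..m}. is_qrohfpr q l n (As t)"
    and "\<forall>t\<in>{1..m}. acceptably_additive_consistent q l n c (As t)"
  shows "acceptably_additive_consistent q l n c (aggregate q l m w As)"
proof -
  have w: "\<forall>t\<in>{1..m}. 0 \<le> w t" and ci: "\<forall>t\<in>{1..m}. CI q l n (As t) \<le> c"
    using assms(7,10) by (auto simp: acceptably_additive_consistent_def)
  have "CI q l n (aggregate q l m w As) \<le> (\<Sum>t\<in>{1..m}. w t * CI q l n (As t))"
    using assms(1,2) w by (intro CI_aggregate_le) auto
  also have "\<dots> \<le> c"
    using weighted_mean_le[OF w assms(8) ci] .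
  finally show ?thesis
    using is_qrohfpr_aggregate[OF _ w assms(8,9)] assms(1)
    by (simp add: acceptably_additive_consistent_def)
qed

end
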